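(* Let $R=(R_t)_{t=0}^T$ be a real-valued adapted process and consider the optimal stopping problem $$(OS)\qquad\text{maximize } ER_\tau\ \text{ over }\tau\in\mathcal T,$$ the relaxed problem $$(ROS)\qquad\text{maximize } E\sum_{t=0}^TR_tx_t\ \text{ over }x\in\mathcal N\ \text{ subject to } x\ge0,\ \sum_{t=0}^Tx_t\le1\ \text{a.s.}$$ and the dual problem $$(D_{OS})\qquad\text{minimize } Ey\ \text{ over }(p,y)\in\mathcal X_a^\perp\times\mathcal Y_+\ \text{ subject to } p_t+R_t\le y,\ t=0,\dots,T\ \text{a.s.}$$ If $\max_tR_t\in\mathcal Y$, then $\sup(OS)=\sup(ROS)=\inf(D_{OS})$, and $(OS)$ and $(ROS)$ have a solution. In this case, a dual feasible $(p,y)$ solves $(D_{OS})$ if and only if there exists a stopping time $\tau\in\mathcal T$ with $p_\tau+R_\tau=y$ almost surely.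
   Context: $(\Omega,\mathcal F,P)$ is a probability space with a filtration $(\mathcal F_t)_{t=0}^T$ (an increasing sequence of sub-$\sigma$-algebras of $\mathcal F$). $\mathcal N$ is the linear space of all real-valued processes $x=(x_t)_{t=0}^T$ (elements of $L^0(\mathbb R^{T+1})$) with $x_t$ $\mathcal F_t$-measurable for every $t$. Random variables equal a.s. are identified. $\mathcal T$ is the set of stopping times: measurable $\tau:\Omega\to\{0,\dots,T+1\}$ with $\{\tau\le t\}\in\mathcal F_t$ for $t=0,\dots,T$. $\tau=T+1$ means not stopping at all, with the conventions $R_{T+1}:=0$ and $p_{T+1}:=0$. In the maximization problems, the expectation of an extended real-valued random variable is $-\infty$ unless its negative part is integrable. A linear space $\mathcal U$ of $\mathbb R^k$-valued random variables is decomposable if $1_Au+1_{\Omega\setminus A}u'\in\mathcal U$ for all $u\in\mathcal U$, $u'\in L^\infty$, $A\in\mathcal F$; it is solid if $\bar u\in\mathcal U$, $u\in L^0$ and $|u^i|\le|\bar u^i|$ a.s. for all components $i$ imply $u\in\mathcal U$. $\mathcal X,\mathcal V$ are solid decomposable spaces of $\mathbb R^{T+1}$-valued random variables in separating duality under $\langle x,v\rangle:=E[x\cdot v]$, and $\mathcal U,\mathcal Y$ are solid decomposable spaces of real-valued random variables in separating duality under $\langle u,y\rangle:=E[uy]$ (in particular $L^\infty\subseteq\mathcal Y\subseteq L^1$). $\mathcal Y_+:=\{y\in\mathcal Y: y\ge0\text{ a.s.}\}$. $\mathcal X_a:=\mathcal X\cap\mathcal N$ and $\mathcal X_a^\perp:=\{v\in\mathcal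 V:\langle x,v\rangle=0\ \forall x\in\mathcal X_a\}$. $(p,y)$ is dual feasible if it satisfies all constraints of $(D_{OS})$, including $y\ge0$. "Solves" means feasible and attaining the optimum value. *)

theory Defs
  imports "HOL-Probability.Probability"
begin

text \<open>
  An \<open>\<real>\<^sup>k\<close>-valued random variable is a function \<open>u :: nat \<Rightarrow> 'a \<Rightarrow> real\<close> of which only the
  components \<open>u i\<close> with \<open>i < k\<close> matter. Functions represent their almost-sure equivalence
  classes: a solid set is closed under almost-sure modification (and under changing the
  components beyond \<open>k\<close>), so the identification of a.s. equal random variables is built in.
\<close>

definition L0 :: "'a measure \<Rightarrow> nat \<Rightarrow> (nat \<Rightarrow> 'a \<Rightarrow> real) set" where
  "L0 M k = {u. \<forall>i<k. u i \<in> borel_measurable M}"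

definition Linf :: "'a measure \<Rightarrow> nat \<Rightarrow> (nat \<Rightarrow> 'a \<Rightarrow> real) set" where
  "Linf M k = {u \<in> L0 M k. \<exists>C. \<forall>i<k. AE \<omega> in M. \<bar>u i \<omega>\<bar> \<le> C}"

definition linear_space :: "(nat \<Rightarrow> 'a \<Rightarrow> real) set \<Rightarrow> bool" where
  "linear_space U \<longleftrightarrow>
     (\<lambda>i \<omega>. 0) \<in> U \<and>
     (\<forall>u\<in>U. \<forall>v\<in>U. (\<lambda>i \<omega>. u i \<omega> + v i \<omega>) \<in> U) \<and>
     (\<forall>c. \<forall>u\<in>U. (\<lambda>i \<omega>. c * u i \<omega>) \<in> U)"

definition decomposable :: "'a measure \<Rightarrow> nat \<Rightarrow> (nat \<Rightarrow> 'a \<Rightarrow> real) set \<Rightarrow> bool" where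
  "decomposable M k U \<longleftrightarrow>
     (\<forall>u\<in>U. \<forall>u'\<in>Linf M k. \<forall>A\<in>sets M. (\<lambda>i \<omega>. if \<omega> \<in> A then u i \<omega> else u' i \<omega>) \<in> U)"

definition solid :: "'a measure \<Rightarrow> nat \<Rightarrow> (nat \<Rightarrow> 'a \<Rightarrow> real) set \<Rightarrow> bool" where
  "solid M k U \<longleftrightarrow>
     (\<forall>ub\<in>U. \<forall>u\<in>L0 M k. (\<forall>i<k. AE \<omega> in M. \<bar>u i \<omega>\<bar> \<le> \<bar>ub i \<omega>\<bar>) \<longrightarrow> u \<in> U)"

definition solid_decomposable_space :: "'a measure \<Rightarrow> nat \<Rightarrow> (nat \<Rightarrow> 'a \<Rightarrow> real) set \<Rightarrow> bool" where
  "solid_decomposable_space M k U \<longleftrightarrow>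
     U \<subseteq> L0 M k \<and> linear_space U \<and> decomposable M k U \<and> solid M k U"

definition pairing :: "'a measure \<Rightarrow> nat \<Rightarrow> (nat \<Rightarrow> 'a \<Rightarrow> real) \<Rightarrow> (nat \<Rightarrow> 'a \<Rightarrow> real) \<Rightarrow> real" where
  "pairing M k x v = (\<integral>\<omega>. (\<Sum>i<k. x i \<omega> * v i \<omega>) \<partial>M)"

definition separating_duality ::
  "'a measure \<Rightarrow> nat \<Rightarrow> (nat \<Rightarrow> 'a \<Rightarrow> real) set \<Rightarrow> (nat \<Rightarrow> 'a \<Rightarrow> real) set \<Rightarrow> bool" where
  "separating_duality M k X V \<longleftrightarrow>
     (\<forall>x\<in>X. \<forall>v\<in>V. integrable M (\<lambda>\<omega>. \<Sum>i<k. x i \<omega> * v i \<omega>)) \<and>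
     (\<forall>x\<in>X. (\<forall>v\<in>V. pairing M k x v = 0) \<longrightarrow> (\<forall>i<k. AE \<omega> in M. x i \<omega> = 0)) \<and>
     (\<forall>v\<in>V. (\<forall>x\<in>X. pairing M k x v = 0) \<longrightarrow> (\<forall>i<k. AE \<omega> in M. v i \<omega> = 0))"

text \<open>A space of real-valued random variables, viewed as a space of \<open>\<real>\<^sup>1\<close>-valued ones.\<close>

definition scalar_space :: "('a \<Rightarrow> real) set \<Rightarrow> (nat \<Rightarrow> 'a \<Rightarrow> real) set" where
  "scalar_space Y = {u. u 0 \<in> Y}"

text \<open>
  The library locale \<open>filtration\<close> and predicate \<open>stopping_time\<close> index by a whole type; here the
  time set is \<open>{0..T}\<close>, and \<open>F t\<close> for \<open>t > T\<close> is irrelevant.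
\<close>

definition finite_filtration :: "'a measure \<Rightarrow> (nat \<Rightarrow> 'a measure) \<Rightarrow> nat \<Rightarrow> bool" where
  "finite_filtration M F T \<longleftrightarrow>
     (\<forall>t\<le>T. subalgebra M (F t)) \<and> (\<forall>s t. s \<le> t \<and> t \<le> T \<longrightarrow> subalgebra (F t) (F s))"

definition adapted_processes :: "(nat \<Rightarrow> 'a measure) \<Rightarrow> nat \<Rightarrow> (nat \<Rightarrow> 'a \<Rightarrow> real) set" where
  "adapted_processes F T = {x. \<forall>t\<le>T. x t \<in> borel_measurable (F t)}"

definition stopping_times :: "'a measure \<Rightarrow> (nat \<Rightarrow> 'a measure) \<Rightarrow> nat \<Rightarrow> ('a \<Rightarrow> nat) set" where
  "stopping_times M F T =
     {\<tau> \<in> measurable M (count_space {0..T + 1}). \<forall>t\<le>T. {\<omega> \<in> space M. \<tau> \<omega> \<le> t} \<in> sets (F t)}"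

text \<open>The random variable \<open>R\<^sub>\<tau>\<close>, with the convention \<open>R\<^sub>T\<^sub>+\<^sub>1 = 0\<close>.\<close>

definition stopped :: "nat \<Rightarrow> (nat \<Rightarrow> 'a \<Rightarrow> real) \<Rightarrow> ('a \<Rightarrow> nat) \<Rightarrow> 'a \<Rightarrow> real" where
  "stopped T R \<tau> \<omega> = (if \<tau> \<omega> \<le> T then R (\<tau> \<omega>) \<omega> else 0)"

text \<open>
  Expectation in the maximization problems: \<open>-\<infinity>\<close> unless the negative part is integrable
  (and \<open>+\<infinity>\<close> if the negative part is integrable but the positive part is not).
\<close>

definition ext_expectation :: "'a measure \<Rightarrow> ('a \<Rightarrow> real) \<Rightarrow> ereal" where
  "ext_expectation M f =
     (if integrable M (\<lambda>\<omega>. max 0 (- f \<omega>))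
      then enn2ereal (\<integral>\<^sup>+\<omega>. ennreal (max 0 (f \<omega>)) \<partial>M) - ereal (\<integral>\<omega>. max 0 (- f \<omega>) \<partial>M)
      else -\<infinity>)"

definition OS_objective :: "'a measure \<Rightarrow> nat \<Rightarrow> (nat \<Rightarrow> 'a \<Rightarrow> real) \<Rightarrow> ('a \<Rightarrow> nat) \<Rightarrow> ereal" where
  "OS_objective M T R \<tau> = ext_expectation M (stopped T R \<tau>)"

definition OS_value ::
  "'a measure \<Rightarrow> (nat \<Rightarrow> 'a measure) \<Rightarrow> nat \<Rightarrow> (nat \<Rightarrow> 'a \<Rightarrow> real) \<Rightarrow> ereal" where
  "OS_value M F T R = (SUP \<tau>\<in>stopping_times M F T. OS_objective M T R \<tau>)"

definition solves_OS ::
  "'a measure \<Rightarrow> (nat \<Rightarrow> 'a measure) \<Rightarrow> nat \<Rightarrow> (nat \<Rightarrow> 'a \<Rightarrow> real) \<Rightarrow> ('a \<Rightarrow> nat) \<Rightarrow> bool" where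
  "solves_OS M F T R \<tau> \<longleftrightarrow>
     \<tau> \<in> stopping_times M F T \<and> OS_objective M T R \<tau> = OS_value M F T R"

definition ROS_feasible ::
  "'a measure \<Rightarrow> (nat \<Rightarrow> 'a measure) \<Rightarrow> nat \<Rightarrow> (nat \<Rightarrow> 'a \<Rightarrow> real) set" where
  "ROS_feasible M F T =
     {x \<in> adapted_processes F T.
        (\<forall>t\<le>T. AE \<omega> in M. 0 \<le> x t \<omega>) \<and> (AE \<omega> in M. (\<Sum>t\<le>T. x t \<omega>) \<le> 1)}"

definition ROS_objective ::
  "'a measure \<Rightarrow> nat \<Rightarrow> (nat \<Rightarrow> 'a \<Rightarrow> real) \<Rightarrow> (nat \<Rightarrow> 'a \<Rightarrow> real) \<Rightarrow> ereal" where
  "ROS_objective M T R x = ext_expectation M (\<lambda>\<omega>. \<Sum>t\<le>T. R t \<omega> * x t \<omega>)"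

definition ROS_value ::
  "'a measure \<Rightarrow> (nat \<Rightarrow> 'a measure) \<Rightarrow> nat \<Rightarrow> (nat \<Rightarrow> 'a \<Rightarrow> real) \<Rightarrow> ereal" where
  "ROS_value M F T R = (SUP x\<in>ROS_feasible M F T. ROS_objective M T R x)"

definition solves_ROS ::
  "'a measure \<Rightarrow> (nat \<Rightarrow> 'a measure) \<Rightarrow> nat \<Rightarrow> (nat \<Rightarrow> 'a \<Rightarrow> real) \<Rightarrow> (nat \<Rightarrow> 'a \<Rightarrow> real) \<Rightarrow> bool" where
  "solves_ROS M F T R x \<longleftrightarrow>
     x \<in> ROS_feasible M F T \<and> ROS_objective M T R x = ROS_value M F T R"

definition adapted_annihilator ::
  "'a measure \<Rightarrow> (nat \<Rightarrow> 'a measure) \<Rightarrow> nat \<Rightarrow> (nat \<Rightarrow> 'a \<Rightarrow> real) set \<Rightarrow> (nat \<Rightarrow> 'a \<Rightarrow> real) set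
    \<Rightarrow> (nat \<Rightarrow> 'a \<Rightarrow> real) set" where
  "adapted_annihilator M F T X V =
     {v \<in> V. \<forall>x \<in> X \<inter> adapted_processes F T. pairing M (T + 1) x v = 0}"

definition dual_feasible ::
  "'a measure \<Rightarrow> (nat \<Rightarrow> 'a measure) \<Rightarrow> nat \<Rightarrow> (nat \<Rightarrow> 'a \<Rightarrow> real) set \<Rightarrow> (nat \<Rightarrow> 'a \<Rightarrow> real) set
    \<Rightarrow> ('a \<Rightarrow> real) set \<Rightarrow> (nat \<Rightarrow> 'a \<Rightarrow> real) \<Rightarrow> ((nat \<Rightarrow> 'a \<Rightarrow> real) \<times> ('a \<Rightarrow> real)) set" where
  "dual_feasible M F T X V Y R =
     {(p, y). p \<in> adapted_annihilator M F T X V \<and> y \<in> Y \<and> (AE \<omega> in M. 0 \<le> y \<omega>) \<and>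
        (\<forall>t\<le>T. AE \<omega> in M. p t \<omega> + R t \<omega> \<le> y \<omega>)}"

text \<open>
  In the duality setting every \<open>y \<in> Y\<close> is integrable, so the dual objective is the Bochner
  integral; the value is taken in the extended reals.
\<close>

definition dual_value ::
  "'a measure \<Rightarrow> (nat \<Rightarrow> 'a measure) \<Rightarrow> nat \<Rightarrow> (nat \<Rightarrow> 'a \<Rightarrow> real) set \<Rightarrow> (nat \<Rightarrow> 'a \<Rightarrow> real) set
    \<Rightarrow> ('a \<Rightarrow> real) set \<Rightarrow> (nat \<Rightarrow> 'a \<Rightarrow> real) \<Rightarrow> ereal" where
  "dual_value M F T X V Y R =
     (INF (p, y)\<in>dual_feasible M F T X V Y R. ereal (\<integral>\<omega>. y \<omega> \<partial>M))"

definition solves_dual ::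
  "'a measure \<Rightarrow> (nat \<Rightarrow> 'a measure) \<Rightarrow> nat \<Rightarrow> (nat \<Rightarrow> 'a \<Rightarrow> real) set \<Rightarrow> (nat \<Rightarrow> 'a \<Rightarrow> real) set
    \<Rightarrow> ('a \<Rightarrow> real) set \<Rightarrow> (nat \<Rightarrow> 'a \<Rightarrow> real) \<Rightarrow> (nat \<Rightarrow> 'a \<Rightarrow> real) \<Rightarrow> ('a \<Rightarrow> real) \<Rightarrow> bool" where
  "solves_dual M F T X V Y R p y \<longleftrightarrow>
     (p, y) \<in> dual_feasible M F T X V Y R \<and>
     ereal (\<integral>\<omega>. y \<omega> \<partial>M) = dual_value M F T X V Y R"

end

theory Submission
  imports Defs
begin

text \<open>
  Backward induction yields a stopping time \<open>\<tau>\<close> and an integrable \<open>y \<ge> 0\<close> with \<open>E y = E R\<^sub>\<tau>\<close> and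
  \<open>R\<^sub>t \<le> E\<^sub>t y\<close> for all \<open>t\<close>. Were \<open>(y - E\<^sub>t y, y)\<close> in \<open>V \<times> Y\<close>, it would be dual feasible with value
  \<open>E R\<^sub>\<tau>\<close>; in general, truncations of \<open>y\<close> give dual feasible pairs whose values converge to \<open>E y\<close>.
  Weak duality closes the chain of inequalities, and complementary slackness characterizes the
  dual solutions, because \<open>E p\<^sub>\<tau> = 0\<close> for every \<open>p\<close> annihilating the adapted processes.
\<close>

section \<open>Extended expectations and Bochner integrals\<close>

lemma ext_expectation_eq_integral:
  assumes f: "integrable M f"
  shows "ext_expectation M f = ereal (\<integral>\<omega>. f \<omega> \<partial>M)"
proof -
  have pos: "integrable M (\<lambda>\<omega>. max 0 (f \<omega>))" and neg: "integrable M (\<lambda>\<omega>. max 0 (- f \<omega>))"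
    using f by auto
  have "(\<integral>\<omega>. f \<omega> \<partial>M) = (\<integral>\<omega>. max 0 (f \<omega>) - max 0 (- f \<omega>) \<partial>M)"
    by (rule Bochner_Integration.integral_cong) auto
  also have "\<dots> = (\<integral>\<omega>. max 0 (f \<omega>) \<partial>M) - (\<integral>\<omega>. max 0 (- f \<omega>) \<partial>M)"
    using pos neg by simp
  finally have split: "(\<integral>\<omega>. f \<omega> \<partial>M) = (\<integral>\<omega>. max 0 (f \<omega>) \<partial>M) - (\<integral>\<omega>. max 0 (- f \<omega>) \<partial>M)" .
  have "(\<integral>\<^sup>+\<omega>. ennreal (max 0 (f \<omega>)) \<partial>M) = ennreal (\<integral>\<omega>. max 0 (f \<omega>) \<partial>M)"
    by (rule nn_integral_eq_integral[OF pos]) simp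
  then show ?thesis
    using neg split by (simp add: ext_expectation_def enn2ereal_ennreal)
qed

text \<open>If the negative part of \<open>f\<close> is not integrable, the left side is minus
  infinity. Otherwise the positive part is bounded by \<open>\<bar>g\<bar>\<close>, so
  \<open>f\<close> is integrable and monotonicity of the integral applies.\<close>

lemma ext_expectation_le_integral:
  assumes f: "f \<in> borel_measurable M" and g: "integrable M g" and le: "AE \<omega> in M. f \<omega> \<le> g \<omega>"
  shows "ext_expectation M f \<le> ereal (\<integral>\<omega>. g \<omega> \<partial>M)"
proof (cases "integrable M (\<lambda>\<omega>. max 0 (- f \<omega>))")
  case True
  have "integrable M (\<lambda>\<omega>. max 0 (f \<omega>))"
    by (rule Bochner_Integration.integrable_bound[OF g]) (use f le in auto)
  then have "integrable M (\<lambda>\<omega>. max 0 (f \<omega>) - max 0 (- f \<omega>))"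
    using True by (rule Bochner_Integration.integrable_diff)
  moreover have "(\<lambda>\<omega>. max 0 (f \<omega>) - max 0 (- f \<omega>)) = f"
    by (auto simp: fun_eq_iff)
  ultimately have int: "integrable M f"
    by simp
  show ?thesis
    using integral_mono_AE[OF int g le] by (simp add: ext_expectation_eq_integral[OF int])
qed (simp add: ext_expectation_def)

section \<open>Solid decomposable spaces and their pairing\<close>

text \<open>Gluing the zero element on the empty set with a bounded \<open>u\<close> on the
  complement leaves \<open>u\<close> itself, so decomposability puts \<open>u\<close> into the
  space.\<close>

lemma Linf_subset_solid_decomposable_space:
  assumes U: "solid_decomposable_space M k U"
  shows "Linf M k \<subseteq> U"
proof
  fix u assume u: "u \<in> Linf M k"
  have zero: "(\<lambda>i \<omega>. 0) \<in> U"
    and dec: "\<forall>v\<in>U. \<forall>u\<in>Linf M k. \<forall>A\<in>sets M. (\<lambda>i \<omega>. if \<omega> \<in> A then v i \<omega> else u i \<omega>) \<in> U"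
    using U by (auto simp: solid_decomposable_space_def linear_space_def decomposable_def)
  show "u \<in> U"
    using bspec[OF bspec[OF bspec[OF dec zero] u] sets.empty_sets] by simp
qed

lemma constant_mem_solid_decomposable_space:
  assumes "solid_decomposable_space M k U"
  shows "(\<lambda>_ _. c) \<in> U"
proof -
  have "(\<lambda>_ _. c) \<in> Linf M k"
    by (auto simp: Linf_def L0_def)
  then show ?thesis
    using Linf_subset_solid_decomposable_space[OF assms] by blast
qed

lemma solid_decomposable_space_dominated:
  assumes "solid_decomposable_space M k U" "v \<in> U" "\<And>i. i < k \<Longrightarrow> u i \<in> borel_measurable M"
    and "\<And>i. i < k \<Longrightarrow> AE \<omega> in M. \<bar>u i \<omega>\<bar> \<le> \<bar>v i \<omega>\<bar>"
  shows "u \<in> U"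
  using assms unfolding solid_decomposable_space_def solid_def L0_def by blast

text \<open>The duality gives integrability of the sum over all components only. Solidity allows all
  components of \<open>x\<close> but one to be set to zero, which isolates a single product.\<close>

lemma separating_duality_component_integrable:
  assumes X: "solid_decomposable_space M k X" and dual: "separating_duality M k X V"
    and x: "x \<in> X" and v: "v \<in> V" and i: "i < k"
  shows "integrable M (\<lambda>\<omega>. x i \<omega> * v i \<omega>)"
proof -
  have "x i \<in> borel_measurable M"
    using X x i by (auto simp: solid_decomposable_space_def L0_def)
  then have "(\<lambda>\<omega>. if j = i then x i \<omega> else 0) \<in> borel_measurable M" for j
    by (cases "j = i") auto
  then have "(\<lambda>j \<omega>. if j = i then x i \<omega> else 0) \<in> X"
    by (intro solid_decomposable_space_dominated[OF X x]) auto
  then have "integrable M (\<lambda>\<omega>. \<Sum>j<k. (if j = i then x i \<omega> else 0) * v j \<omega>)"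
    using dual v unfolding separating_duality_def by fast
  moreover have "(\<Sum>j<k. (if j = i then x i \<omega> else 0) * v j \<omega>) = x i \<omega> * v i \<omega>" for \<omega>
  proof -
    have "(\<Sum>j<k. (if j = i then x i \<omega> else 0) * v j \<omega>) = (\<Sum>j<k. if j = i then x i \<omega> * v i \<omega> else 0)"
      by (rule sum.cong) auto
    then show ?thesis
      using i by simp
  qed
  ultimately show ?thesis
    by simp
qed

section \<open>Stopping times of a finite filtration and their indicator processes\<close>

locale filtered_prob_space = prob_space M for M :: "'a measure" +
  fixes F :: "nat \<Rightarrow> 'a measure" and T :: nat
  assumes filtration: "finite_filtration M F T"
begin

lemma subalgebra_F: "t \<le> T \<Longrightarrow> subalgebra M (F t)"
  using filtration by (simp add: finite_filtration_def)

lemma sets_F_mono: "s \<le> t \<Longrightarrow> t \<le> T \<Longrightarrow> sets (F s) \<subseteq> sets (F t)"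
  using filtration by (auto simp: finite_filtration_def subalgebra_def)

lemma sets_F_subset: "t \<le> T \<Longrightarrow> sets (F t) \<subseteq> sets M"
  using subalgebra_F by (auto simp: subalgebra_def)

lemma space_F: "t \<le> T \<Longrightarrow> space (F t) = space M"
  using subalgebra_F by (auto simp: subalgebra_def)

lemma cond_exp_locale: "t \<le> T \<Longrightarrow> finite_measure_subalgebra M (F t)"
  using subalgebra_F by (intro finite_measure_subalgebra.intro finite_measure_axioms
      finite_measure_subalgebra_axioms.intro)

lemma measurable_F_imp_M: "t \<le> T \<Longrightarrow> f \<in> borel_measurable (F t) \<Longrightarrow> f \<in> borel_measurable M"
  using subalgebra_F measurable_from_subalg by blast

lemma adapted_measurable: "x \<in> adapted_processes F T \<Longrightarrow> t \<le> T \<Longrightarrow> x t \<in> borel_measurable M"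
  by (auto simp: adapted_processes_def intro: measurable_F_imp_M)

lemma stopping_time_eq_sets:
  assumes \<tau>: "\<tau> \<in> stopping_times M F T" and t: "t \<le> T"
  shows "{\<omega> \<in> space M. \<tau> \<omega> = t} \<in> sets (F t)"
proof -
  have le: "{\<omega> \<in> space M. \<tau> \<omega> \<le> s} \<in> sets (F t)" if "s \<le> t" for s
    using \<tau> that t sets_F_mono[of s t] by (auto simp: stopping_times_def)
  show ?thesis
  proof (cases t)
    case 0
    then show ?thesis using le[of 0] by simp
  next
    case (Suc s)
    have "{\<omega> \<in> space M. \<tau> \<omega> = t} = {\<omega> \<in> space M. \<tau> \<omega> \<le> t} - {\<omega> \<in> space M. \<tau> \<omega> \<le> s}"
      using Suc by auto
    then show ?thesis
      using le[of t] le[of s] Suc by simp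
  qed
qed

lemma stopping_indicator_adapted:
  assumes "\<tau> \<in> stopping_times M F T"
  shows "(\<lambda>t. indicator {\<omega> \<in> space M. \<tau> \<omega> = t}) \<in> adapted_processes F T"
  using stopping_time_eq_sets[OF assms]
  by (auto simp: adapted_processes_def intro!: borel_measurable_indicator)

text \<open>At most one term survives. When \<open>\<tau> \<omega> = T + 1\<close> none does, which
  matches the value 0 of \<open>stopped\<close> there.\<close>

lemma sum_stopping_indicator:
  assumes "\<omega> \<in> space M"
  shows "(\<Sum>t\<le>T. S t \<omega> * indicator {\<omega> \<in> space M. \<tau> \<omega> = t} \<omega>) = stopped T S \<tau> \<omega>"
proof -
  have "(\<Sum>t\<le>T. S t \<omega> * indicator {\<omega> \<in> space M. \<tau> \<omega> = t} \<omega>) = (\<Sum>t\<le>T. if t = \<tau> \<omega> then S (\<tau> \<omega>) \<omega> else 0)"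
    using assms by (intro sum.cong) (auto simp: indicator_def)
  then show ?thesis
    by (simp add: stopped_def)
qed

lemma stopping_indicator_feasible:
  assumes "\<tau> \<in> stopping_times M F T"
  shows "(\<lambda>t. indicator {\<omega> \<in> space M. \<tau> \<omega> = t}) \<in> ROS_feasible M F T"
proof -
  have "(\<Sum>t\<le>T. indicator {\<omega> \<in> space M. \<tau> \<omega> = t} \<omega>) \<le> (1::real)" if "\<omega> \<in> space M" for \<omega>
    using sum_stopping_indicator[OF that, of "\<lambda>_ _. 1" \<tau>] by (simp add: stopped_def)
  then show ?thesis
    using stopping_indicator_adapted[OF assms] by (auto simp: ROS_feasible_def)
qed

text \<open>The relaxed problem extends the original one. The two integrands agree on
  \<open>space M\<close> only, so each ingredient of \<open>ext_expectation\<close> is transferred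
  by a congruence rule.\<close>

lemma ROS_objective_stopping_indicator:
  "ROS_objective M T R (\<lambda>t. indicator {\<omega> \<in> space M. \<tau> \<omega> = t}) = OS_objective M T R \<tau>"
proof -
  define f where "f = (\<lambda>\<omega>. \<Sum>t\<le>T. R t \<omega> * indicator {\<omega> \<in> space M. \<tau> \<omega> = t} \<omega>)"
  have eq: "f \<omega> = stopped T R \<tau> \<omega>" if "\<omega> \<in> space M" for \<omega>
    unfolding f_def by (rule sum_stopping_indicator[OF that])
  have "integrable M (\<lambda>\<omega>. max 0 (- f \<omega>)) \<longleftrightarrow> integrable M (\<lambda>\<omega>. max 0 (- stopped T R \<tau> \<omega>))"
    by (rule Bochner_Integration.integrable_cong[OF refl]) (simp add: eq)
  moreover have "(\<integral>\<^sup>+\<omega>. ennreal (max 0 (f \<omega>)) \<partial>M) = (\<integral>\<^sup>+\<omega>. ennreal (max 0 (stopped T R \<tau> \<omega>)) \<partial>M)"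
    by (rule nn_integral_cong) (simp add: eq)
  moreover have "(\<integral>\<omega>. max 0 (- f \<omega>) \<partial>M) = (\<integral>\<omega>. max 0 (- stopped T R \<tau> \<omega>) \<partial>M)"
    by (rule Bochner_Integration.integral_cong[OF refl]) (simp add: eq)
  ultimately show ?thesis
    unfolding ROS_objective_def OS_objective_def ext_expectation_def f_def[symmetric] by simp
qed

section \<open>Snell envelope by backward induction\<close>

text \<open>Since \<open>\<tau>\<close> stops strictly after \<open>t\<close>, the new time stops by
  \<open>s\<close> on the empty set if \<open>s < t\<close>, and on \<open>B\<close> united with
  \<open>{\<tau> \<le> s}\<close> otherwise; \<open>B\<close> is then known at time
  \<open>s\<close>.\<close>

lemma stopping_time_if:
  assumes t: "t \<le> T" and B: "B \<in> sets (F t)" and \<tau>: "\<tau> \<in> stopping_times M F T"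
    and later: "\<And>\<omega>. \<omega> \<in> space M \<Longrightarrow> t < \<tau> \<omega>"
  shows "(\<lambda>\<omega>. if \<omega> \<in> B then t else \<tau> \<omega>) \<in> stopping_times M F T"
proof -
  have \<tau>_meas: "\<tau> \<in> measurable M (count_space {0..T + 1})" and BM: "B \<in> sets M"
    using \<tau> B t sets_F_subset by (auto simp: stopping_times_def)
  have "(\<lambda>\<omega>. if \<omega> \<in> B then t else \<tau> \<omega>) \<in> measurable M (count_space {0..T + 1})"
    using t \<tau>_meas BM by (intro measurable_If_set measurable_const sets.Int sets.top) auto
  moreover have "{\<omega> \<in> space M. (if \<omega> \<in> B then t else \<tau> \<omega>) \<le> s} \<in> sets (F s)" if s: "s \<le> T" for s
  proof (cases "t \<le> s")
    case True
    have "{\<omega> \<in> space M. (if \<omega> \<in> B then t else \<tau> \<omega>) \<le> s} = B \<union> {\<omega> \<in> space M. \<tau> \<omega> \<le> s}"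
      using True sets.sets_into_space[OF BM] later by auto
    moreover have "B \<in> sets (F s)"
      using B sets_F_mono[OF True s] by auto
    ultimately show ?thesis
      using \<tau> s by (auto simp: stopping_times_def)
  next
    case False
    then have "{\<omega> \<in> space M. (if \<omega> \<in> B then t else \<tau> \<omega>) \<le> s} = {}"
      by (auto dest: later)
    then show ?thesis by (simp only: sets.empty_sets)
  qed
  ultimately show ?thesis
    by (simp add: stopping_times_def)
qed

text \<open>
  Backward induction on \<open>t\<close>. The variable \<open>y\<close> grows by \<open>(R\<^sub>t - E\<^sub>t y)\<^sup>+\<close> in the step at time \<open>t\<close>, so that
  \<open>E\<^sub>t y\<close> becomes the Snell envelope at \<open>t\<close>.
\<close>
lemma snell:
  assumes R: "R \<in> adapted_processes F T"
    and pos: "\<And>t. t \<le> T \<Longrightarrow> integrable M (\<lambda>\<omega>. max 0 (R t \<omega>))"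
    and "t \<le> T + 1"
  shows "\<exists>y \<tau>. integrable M y \<and> (\<forall>\<omega>. 0 \<le> y \<omega>) \<and> \<tau> \<in> stopping_times M F T
    \<and> (\<forall>\<omega>\<in>space M. t \<le> \<tau> \<omega>) \<and> integrable M (stopped T R \<tau>)
    \<and> (\<forall>s. t \<le> s \<and> s \<le> T \<longrightarrow> (AE \<omega> in M. R s \<omega> \<le> real_cond_exp M (F s) y \<omega>))
    \<and> (\<forall>s A. s \<le> t \<and> s \<le> T \<and> A \<in> sets (F s) \<longrightarrow>
        (\<integral>\<omega>. indicator A \<omega> * y \<omega> \<partial>M) = (\<integral>\<omega>. indicator A \<omega> * stopped T R \<tau> \<omega> \<partial>M))"
  using \<open>t \<le> T + 1\<close>
\<comment> \<open>The induction runs from \<open>T + 1\<close> down to \<open>t\<close>. The last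
  clause ranges over all \<open>s \<le> t\<close> with \<open>s \<le> T\<close> because
  \<open>F (T + 1)\<close> carries no meaning; at \<open>Suc t\<close> it supplies the sets of
  \<open>F t\<close> that the step requires.\<close>
proof (induction rule: inc_induct)
  case base
  have "(\<lambda>_. T + 1) \<in> stopping_times M F T"
    by (auto simp: stopping_times_def)
  moreover have "stopped T R (\<lambda>_. T + 1) = (\<lambda>_. 0)"
    by (auto simp: stopped_def)
  ultimately show ?case
    by (intro exI[of _ "\<lambda>_. 0"] exI[of _ "\<lambda>_. T + 1"]) auto
next
  case (step t)
  then have t: "t \<le> T" by simp
  obtain y \<tau> where y: "integrable M y" "\<And>\<omega>. 0 \<le> y \<omega>" and \<tau>: "\<tau> \<in> stopping_times M F T"
    and later: "\<And>\<omega>. \<omega> \<in> space M \<Longrightarrow> t < \<tau> \<omega>" and R\<tau>: "integrable M (stopped T R \<tau>)"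
    and env: "\<And>s. t < s \<Longrightarrow> s \<le> T \<Longrightarrow> AE \<omega> in M. R s \<omega> \<le> real_cond_exp M (F s) y \<omega>"
    and eq: "\<And>A. A \<in> sets (F t) \<Longrightarrow>
        (\<integral>\<omega>. indicator A \<omega> * y \<omega> \<partial>M) = (\<integral>\<omega>. indicator A \<omega> * stopped T R \<tau> \<omega> \<partial>M)"
  proof -
    from step.IH obtain y \<tau> where *: "integrable M y" "\<forall>\<omega>. 0 \<le> y \<omega>" "\<tau> \<in> stopping_times M F T"
      "\<forall>\<omega>\<in>space M. Suc t \<le> \<tau> \<omega>" "integrable M (stopped T R \<tau>)"
      "\<forall>s. Suc t \<le> s \<and> s \<le> T \<longrightarrow> (AE \<omega> in M. R s \<omega> \<le> real_cond_exp M (F s) y \<omega>)"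
      "\<forall>s A. s \<le> Suc t \<and> s \<le> T \<and> A \<in> sets (F s) \<longrightarrow>
        (\<integral>\<omega>. indicator A \<omega> * y \<omega> \<partial>M) = (\<integral>\<omega>. indicator A \<omega> * stopped T R \<tau> \<omega> \<partial>M)"
      by blast
    show thesis
    proof (rule that[of y \<tau>])
      fix A assume "A \<in> sets (F t)"
      then show "(\<integral>\<omega>. indicator A \<omega> * y \<omega> \<partial>M) = (\<integral>\<omega>. indicator A \<omega> * stopped T R \<tau> \<omega> \<partial>M)"
        using *(7)[rule_format, of t A] t by simp
    qed (use * t in \<open>auto simp: Suc_le_eq\<close>)
  qed
  interpret Ft: finite_measure_subalgebra M "F t"
    by (rule cond_exp_locale[OF t])
  \<comment> \<open>\<open>C\<close> is the value of continuing at time \<open>t\<close>: by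
    \<open>eq\<close>, \<open>y\<close> and the reward stopped after \<open>t\<close> have the same
    integral over every set of \<open>F t\<close>.\<close>
  define C where "C = real_cond_exp M (F t) y"
  have C_F [measurable]: "C \<in> borel_measurable (F t)"
    by (simp add: C_def)
  have C: "integrable M C" and C_nonneg: "AE \<omega> in M. 0 \<le> C \<omega>"
    using y by (auto simp: C_def intro!: Ft.real_cond_exp_int Ft.real_cond_exp_pos)
  have R_F [measurable]: "R t \<in> borel_measurable (F t)"
    using R t by (simp add: adapted_processes_def)
  have R_M: "R t \<in> borel_measurable M"
    using R_F t by (rule measurable_F_imp_M[rotated])
  \<comment> \<open>\<open>B\<close> is the region where stopping at once is at least as good as
    continuing; off \<open>B\<close> the increment \<open>D\<close> below vanishes.\<close>
  define B where "B = {\<omega> \<in> space M. C \<omega> \<le> R t \<omega>}"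
  have B: "B \<in> sets (F t)"
  proof -
    have "{\<omega> \<in> space (F t). C \<omega> \<le> R t \<omega>} \<in> sets (F t)"
      by measurable
    then show ?thesis
      by (simp add: B_def space_F[OF t])
  qed
  define D where "D \<omega> = max 0 (R t \<omega> - C \<omega>)" for \<omega>
  have D_nonneg: "0 \<le> D \<omega>" for \<omega>
    by (simp add: D_def)
  \<comment> \<open>The hypothesis concerns only the positive part of \<open>R t\<close>; it
    suffices because \<open>D\<close> is at most that positive part plus
    \<open>\<bar>C\<bar>\<close>.\<close>
  have D: "integrable M D"
    unfolding D_def
    by (rule Bochner_Integration.integrable_bound[OF Bochner_Integration.integrable_add
          [OF pos[OF t] integrable_abs[OF C]]]) (use R_M C in auto)
  define \<sigma> where "\<sigma> \<omega> = (if \<omega> \<in> B then t else \<tau> \<omega>)" for \<omega>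
  have \<sigma>: "\<sigma> \<in> stopping_times M F T"
    using stopping_time_if[OF t B \<tau> later] by (simp add: \<sigma>_def[abs_def])
  have BM: "B \<in> sets M"
    using B sets_F_subset[OF t] by auto
  have stopped_\<sigma>: "stopped T R \<sigma> \<omega> = indicator B \<omega> * R t \<omega> + indicator (space M - B) \<omega> * stopped T R \<tau> \<omega>"
    if "\<omega> \<in> space M" for \<omega>
    using that t by (auto simp: stopped_def \<sigma>_def indicator_def)
  \<comment> \<open>On \<open>B\<close> almost surely \<open>R t \<ge> C \<ge> 0\<close>, so
    \<open>R t\<close> coincides there with its integrable positive part. This is where the
    nonnegativity of \<open>y\<close> enters.\<close>
  have BR: "integrable M (\<lambda>\<omega>. indicator B \<omega> * R t \<omega>)"
    by (rule Bochner_Integration.integrable_bound[OF pos[OF t]])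
      (use C_nonneg R_M BM in \<open>auto simp: B_def indicator_def\<close>)
  have BcR: "integrable M (\<lambda>\<omega>. indicator (space M - B) \<omega> * stopped T R \<tau> \<omega>)"
    using integrable_mult_indicator[of "space M - B", OF _ R\<tau>] BM by simp
  have R\<sigma>: "integrable M (stopped T R \<sigma>)"
  proof -
    have "integrable M (stopped T R \<sigma>) \<longleftrightarrow>
        integrable M (\<lambda>\<omega>. indicator B \<omega> * R t \<omega> + indicator (space M - B) \<omega> * stopped T R \<tau> \<omega>)"
      by (rule Bochner_Integration.integrable_cong[OF refl]) (rule stopped_\<sigma>)
    then show ?thesis
      using BR BcR by simp
  qed
  show ?case
  proof (intro exI conjI allI impI ballI)
    show "integrable M (\<lambda>\<omega>. y \<omega> + D \<omega>)"
      using y(1) D by simp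
    show "0 \<le> y \<omega> + D \<omega>" for \<omega>
      using y(2) D_nonneg by simp
    show "\<sigma> \<in> stopping_times M F T" "integrable M (stopped T R \<sigma>)"
      by (fact \<sigma>, fact R\<sigma>)
    show "t \<le> \<sigma> \<omega>" if "\<omega> \<in> space M" for \<omega>
      using later[OF that] by (simp add: \<sigma>_def)
  next
    fix s assume s: "t \<le> s \<and> s \<le> T"
    show "AE \<omega> in M. R s \<omega> \<le> real_cond_exp M (F s) (\<lambda>\<omega>. y \<omega> + D \<omega>) \<omega>"
    proof (cases "s = t")
      \<comment> \<open>As \<open>D\<close> is known at time \<open>t\<close>, conditioning
        \<open>y + D\<close> on \<open>F t\<close> gives \<open>C + D\<close>, the maximum of
        \<open>C\<close> and \<open>R t\<close>.\<close>
      case True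
      have "AE \<omega> in M. real_cond_exp M (F t) (\<lambda>\<omega>. y \<omega> + D \<omega>) \<omega> = C \<omega> + real_cond_exp M (F t) D \<omega>"
        unfolding C_def using y(1) D by (rule Ft.real_cond_exp_add)
      moreover have "AE \<omega> in M. real_cond_exp M (F t) D \<omega> = D \<omega>"
        using D by (rule Ft.real_cond_exp_F_meas) (simp add: D_def[abs_def])
      ultimately show ?thesis
        unfolding True by eventually_elim (simp add: D_def)
    next
      \<comment> \<open>At later times the inequality survives because adding
        \<open>D \<ge> 0\<close> can only raise the conditional expectation.\<close>
      case False
      interpret Fs: finite_measure_subalgebra M "F s"
        using s by (intro cond_exp_locale) simp
      have "AE \<omega> in M. real_cond_exp M (F s) y \<omega> \<le> real_cond_exp M (F s) (\<lambda>\<omega>. y \<omega> + D \<omega>) \<omega>"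
        using y(1) D Bochner_Integration.integrable_add[OF y(1) D]
        by (intro Fs.real_cond_exp_mono) (auto simp: D_nonneg)
      then show ?thesis
        using env[of s] s False by fastforce
    qed
  next
    fix s A assume A: "s \<le> t \<and> s \<le> T \<and> A \<in> sets (F s)"
    then have AF: "A \<in> sets (F t)"
      using sets_F_mono[of s t] t by auto
    have AM: "A \<in> sets M"
      using AF sets_F_subset[OF t] by auto
    have AB: "A \<inter> B \<in> sets (F t)" and AmB: "A - B \<in> sets (F t)" and ABM: "A \<inter> B \<in> sets M" "A - B \<in> sets M"
      using AF B AM BM by auto
    have ind: "integrable M (\<lambda>\<omega>. indicator E \<omega> * f \<omega>)" if "E \<in> sets M" "integrable M f" for E and f :: "'a \<Rightarrow> real"
      using integrable_mult_indicator[OF that] by simp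
    have ABR: "integrable M (\<lambda>\<omega>. indicator (A \<inter> B) \<omega> * R t \<omega>)"
      using ind[OF AM BR] by (simp add: indicator_inter_arith mult.assoc)
    \<comment> \<open>On \<open>A \<inter> B\<close> the integral of \<open>C\<close> cancels that
      of \<open>y\<close> and leaves \<open>R t\<close>. On \<open>A - B\<close> the increment
      vanishes and \<open>eq\<close> replaces \<open>y\<close> by the reward stopped at
      \<open>\<tau>\<close>.\<close>
    have "(\<integral>\<omega>. indicator A \<omega> * (y \<omega> + D \<omega>) \<partial>M)
        = (\<integral>\<omega>. indicator (A - B) \<omega> * y \<omega> + indicator (A \<inter> B) \<omega> * y \<omega>
            + (indicator (A \<inter> B) \<omega> * R t \<omega> - indicator (A \<inter> B) \<omega> * C \<omega>) \<partial>M)"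
      using sets.sets_into_space[OF AM]
      by (intro Bochner_Integration.integral_cong) (auto simp: indicator_def D_def B_def)
    also have "\<dots> = (\<integral>\<omega>. indicator (A - B) \<omega> * y \<omega> \<partial>M) + (\<integral>\<omega>. indicator (A \<inter> B) \<omega> * y \<omega> \<partial>M)
        + ((\<integral>\<omega>. indicator (A \<inter> B) \<omega> * R t \<omega> \<partial>M) - (\<integral>\<omega>. indicator (A \<inter> B) \<omega> * C \<omega> \<partial>M))"
      using ind[OF ABM(2) y(1)] ind[OF ABM(1) y(1)] ABR ind[OF ABM(1) C] by simp
    also have "(\<integral>\<omega>. indicator (A \<inter> B) \<omega> * C \<omega> \<partial>M) = (\<integral>\<omega>. indicator (A \<inter> B) \<omega> * y \<omega> \<partial>M)"
      unfolding C_def using ind[OF ABM(1) y(1)] AB y(1)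
      by (intro Ft.real_cond_exp_intg(2)) auto
    also have "(\<integral>\<omega>. indicator (A - B) \<omega> * y \<omega> \<partial>M) = (\<integral>\<omega>. indicator (A - B) \<omega> * stopped T R \<tau> \<omega> \<partial>M)"
      by (rule eq[OF AmB])
    also have "(\<integral>\<omega>. indicator (A - B) \<omega> * stopped T R \<tau> \<omega> \<partial>M) + (\<integral>\<omega>. indicator (A \<inter> B) \<omega> * y \<omega> \<partial>M)
        + ((\<integral>\<omega>. indicator (A \<inter> B) \<omega> * R t \<omega> \<partial>M) - (\<integral>\<omega>. indicator (A \<inter> B) \<omega> * y \<omega> \<partial>M))
        = (\<integral>\<omega>. indicator (A - B) \<omega> * stopped T R \<tau> \<omega> + indicator (A \<inter> B) \<omega> * R t \<omega> \<partial>M)"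
      using ind[OF ABM(2) R\<tau>] ABR by simp
    also have "\<dots> = (\<integral>\<omega>. indicator A \<omega> * stopped T R \<sigma> \<omega> \<partial>M)"
      using stopped_\<sigma> by (intro Bochner_Integration.integral_cong) (auto simp: indicator_def)
    finally show "(\<integral>\<omega>. indicator A \<omega> * (y \<omega> + D \<omega>) \<partial>M) = (\<integral>\<omega>. indicator A \<omega> * stopped T R \<sigma> \<omega> \<partial>M)" .
  qed
qed

end

section \<open>The duality setting\<close>

locale stopping_duality = filtered_prob_space M F T
  for M :: "'a measure" and F :: "nat \<Rightarrow> 'a measure" and T :: nat +
  fixes X V :: "(nat \<Rightarrow> 'a \<Rightarrow> real) set" and U Y :: "('a \<Rightarrow> real) set"
    and R :: "nat \<Rightarrow> 'a \<Rightarrow> real"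
  assumes X: "solid_decomposable_space M (T + 1) X"
    and V: "solid_decomposable_space M (T + 1) V"
    and XV: "separating_duality M (T + 1) X V"
    and U: "solid_decomposable_space M 1 (scalar_space U)"
    and Y: "solid_decomposable_space M 1 (scalar_space Y)"
    and UY: "separating_duality M 1 (scalar_space U) (scalar_space Y)"
    and R: "R \<in> adapted_processes F T"
    and max_R: "(\<lambda>\<omega>. Max ((\<lambda>t. R t \<omega>) ` {0..T})) \<in> Y"
begin

text \<open>Pair \<open>y\<close> with the constant 1, which belongs to \<open>U\<close> because it
  is bounded.\<close>

lemma Y_integrable:
  assumes "y \<in> Y"
  shows "integrable M y"
proof -
  have "(\<lambda>_ _. 1) \<in> scalar_space U"
    by (rule constant_mem_solid_decomposable_space[OF U])
  moreover have "(\<lambda>_. y) \<in> scalar_space Y"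
    using assms by (simp add: scalar_space_def)
  ultimately show ?thesis
    using UY by (auto simp: separating_duality_def dest!: bspec)
qed

text \<open>Solidity of \<open>Y\<close> extends to domination up to an additive constant, since
  constants lie in \<open>Y\<close>. The constant will be a truncation height.\<close>

lemma Y_dominated:
  assumes z: "z \<in> Y" and y: "y \<in> borel_measurable M" and le: "AE \<omega> in M. \<bar>y \<omega>\<bar> \<le> \<bar>z \<omega>\<bar> + c" and c: "0 \<le> c"
  shows "y \<in> Y"
proof -
  have zS: "(\<lambda>_. z) \<in> scalar_space Y"
    using z by (simp add: scalar_space_def)
  have "z \<in> borel_measurable M"
    using Y_integrable[OF z] by simp
  then have "(\<lambda>_ \<omega>. \<bar>z \<omega>\<bar>) \<in> scalar_space Y"
    by (intro solid_decomposable_space_dominated[OF Y zS]) auto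
  moreover have "(\<lambda>_ _. c) \<in> scalar_space Y"
    by (rule constant_mem_solid_decomposable_space[OF Y])
  ultimately have "(\<lambda>_ \<omega>. \<bar>z \<omega>\<bar> + c) \<in> scalar_space Y"
    using Y unfolding solid_decomposable_space_def linear_space_def by fast
  then have "(\<lambda>_. y) \<in> scalar_space Y"
    by (rule solid_decomposable_space_dominated[OF Y]) (use y le c in auto)
  then show ?thesis
    by (simp add: scalar_space_def)
qed

lemma R_le_max: "t \<le> T \<Longrightarrow> R t \<omega> \<le> Max ((\<lambda>t. R t \<omega>) ` {0..T})"
  by (intro Max_ge) auto

text \<open>Bounded processes belong to \<open>X\<close>, so bounded adapted ones are legitimate
  tests for the annihilator. The lemma serves both relaxed strategies and indicator processes of
  stopping times.\<close>

lemma bounded_adapted_pairing: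
  assumes p: "p \<in> adapted_annihilator M F T X V"
    and x: "x \<in> adapted_processes F T" "\<And>t. t \<le> T \<Longrightarrow> AE \<omega> in M. \<bar>x t \<omega>\<bar> \<le> 1"
  shows "integrable M (\<lambda>\<omega>. \<Sum>t\<le>T. x t \<omega> * p t \<omega>)" "(\<integral>\<omega>. (\<Sum>t\<le>T. x t \<omega> * p t \<omega>) \<partial>M) = 0"
proof -
  have "x \<in> Linf M (T + 1)"
    using x adapted_measurable[OF x(1)] by (auto simp: Linf_def L0_def intro!: exI[of _ 1])
  then have xX: "x \<in> X"
    using Linf_subset_solid_decomposable_space[OF X] by auto
  have "{..<T + 1} = {..T}" by auto
  then show "integrable M (\<lambda>\<omega>. \<Sum>t\<le>T. x t \<omega> * p t \<omega>)"
    using p xX XV unfolding adapted_annihilator_def separating_duality_def by auto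
  show "(\<integral>\<omega>. (\<Sum>t\<le>T. x t \<omega> * p t \<omega>) \<partial>M) = 0"
    using \<open>{..<T + 1} = {..T}\<close> p xX x(1) unfolding adapted_annihilator_def pairing_def by auto
qed

section \<open>Weak duality and the inequalities between the values\<close>

text \<open>Multiply \<open>p t + R t \<le> y\<close> by \<open>x t \<ge> 0\<close> and sum over
  \<open>t\<close>. As \<open>y \<ge> 0\<close> and the \<open>x t\<close> sum to at most 1, the
  reward is at most \<open>y\<close> minus a sum of expectation zero. The reward may fail to be
  integrable, hence the use of \<open>ext_expectation_le_integral\<close>.\<close>

lemma weak_duality:
  assumes x: "x \<in> ROS_feasible M F T" and py: "(p, y) \<in> dual_feasible M F T X V Y R"
  shows "ROS_objective M T R x \<le> ereal (\<integral>\<omega>. y \<omega> \<partial>M)"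
proof -
  have ad: "x \<in> adapted_processes F T" and pos: "AE \<omega> in M. \<forall>t\<in>{..T}. 0 \<le> x t \<omega>"
    and sum: "AE \<omega> in M. (\<Sum>t\<le>T. x t \<omega>) \<le> 1"
    using x by (auto simp: ROS_feasible_def AE_finite_all)
  have p: "p \<in> adapted_annihilator M F T X V" and y: "integrable M y" and y_pos: "AE \<omega> in M. 0 \<le> y \<omega>"
    and le: "AE \<omega> in M. \<forall>t\<in>{..T}. p t \<omega> + R t \<omega> \<le> y \<omega>"
    using py by (auto simp: dual_feasible_def AE_finite_all intro: Y_integrable)
  have bd: "AE \<omega> in M. \<bar>x t \<omega>\<bar> \<le> 1" if "t \<le> T" for t
    using pos sum
  proof eventually_elim
    case (elim \<omega>)
    have "x t \<omega> \<le> (\<Sum>t\<le>T. x t \<omega>)"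
      using elim that by (intro member_le_sum) auto
    then show ?case using elim that by auto
  qed
  note xp = bounded_adapted_pairing[OF p ad bd]
  have "AE \<omega> in M. (\<Sum>t\<le>T. R t \<omega> * x t \<omega>) \<le> y \<omega> - (\<Sum>t\<le>T. x t \<omega> * p t \<omega>)"
    using pos sum y_pos le
  proof eventually_elim
    case (elim \<omega>)
    have "(\<Sum>t\<le>T. R t \<omega> * x t \<omega>) \<le> (\<Sum>t\<le>T. (y \<omega> - p t \<omega>) * x t \<omega>)"
      using elim by (intro sum_mono mult_right_mono) (auto simp: algebra_simps)
    also have "\<dots> = y \<omega> * (\<Sum>t\<le>T. x t \<omega>) - (\<Sum>t\<le>T. x t \<omega> * p t \<omega>)"
      by (simp add: left_diff_distrib sum_subtractf sum_distrib_left mult.commute[of "x _ _"])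
    also have "\<dots> \<le> y \<omega> - (\<Sum>t\<le>T. x t \<omega> * p t \<omega>)"
      using mult_left_le[of "\<Sum>t\<le>T. x t \<omega>" "y \<omega>"] elim by simp
    finally show ?case .
  qed
  moreover have "(\<lambda>\<omega>. \<Sum>t\<le>T. R t \<omega> * x t \<omega>) \<in> borel_measurable M"
    using adapted_measurable[OF R] adapted_measurable[OF ad] by auto
  ultimately show ?thesis
    using ext_expectation_le_integral[of _ M "\<lambda>\<omega>. y \<omega> - (\<Sum>t\<le>T. x t \<omega> * p t \<omega>)"] y xp
    by (simp add: ROS_objective_def)
qed

lemma ROS_value_le_dual_value: "ROS_value M F T R \<le> dual_value M F T X V Y R"
  unfolding ROS_value_def dual_value_def
  by (rule SUP_least, rule INF_greatest) (auto intro: weak_duality)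

lemma OS_value_le_ROS_value: "OS_value M F T R \<le> ROS_value M F T R"
  unfolding OS_value_def ROS_value_def
proof (rule SUP_least)
  fix \<tau> assume "\<tau> \<in> stopping_times M F T"
  then have "ROS_objective M T R (\<lambda>t. indicator {\<omega> \<in> space M. \<tau> \<omega> = t}) \<le> (SUP x\<in>ROS_feasible M F T. ROS_objective M T R x)"
    by (intro SUP_upper stopping_indicator_feasible)
  then show "OS_objective M T R \<tau> \<le> (SUP x\<in>ROS_feasible M F T. ROS_objective M T R x)"
    by (simp add: ROS_objective_stopping_indicator)
qed

section \<open>Strong duality by truncation\<close>

text \<open>
  The natural dual solution \<open>(y - E\<^sub>t y, y)\<close> need not lie in \<open>V \<times> Y\<close>, so it is approximated by
  truncating \<open>y\<close> at height \<open>n\<close> and correcting the second component by what the truncation removes.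
\<close>
lemma truncated_dual_value_le:
  fixes n :: nat
  assumes y: "integrable M y" "\<And>\<omega>. 0 \<le> y \<omega>"
    and env: "\<And>t. t \<le> T \<Longrightarrow> AE \<omega> in M. R t \<omega> \<le> real_cond_exp M (F t) y \<omega>"
  defines "m \<equiv> \<lambda>\<omega>. min (y \<omega>) (real n)"
  shows "dual_value M F T X V Y R
    \<le> ereal ((\<integral>\<omega>. m \<omega> \<partial>M) + real (T + 1) * ((\<integral>\<omega>. y \<omega> \<partial>M) - (\<integral>\<omega>. m \<omega> \<partial>M)))"
proof -
  define Z where "Z = (\<lambda>\<omega>. Max ((\<lambda>t. R t \<omega>) ` {0..T}))"
  define e where "e t = real_cond_exp M (F t) m" for t
  \<comment> \<open>Almost surely \<open>d t\<close> is the conditional expectation of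
    \<open>y - m\<close>, so its mean is what the truncation removes. The absolute value makes it
    nonnegative at every point.\<close>
  define d where "d t = (\<lambda>\<omega>. \<bar>real_cond_exp M (F t) y \<omega> - e t \<omega>\<bar>)" for t
  define p where "p t = (\<lambda>\<omega>. m \<omega> - e t \<omega>)" for t
  \<comment> \<open>Each argument of the minimum dominates \<open>p t + R t\<close> almost surely:
    the first because \<open>p t \<le> n\<close>, the second because
    \<open>R t - e t \<le> d t\<close>. The first places \<open>z\<close> in \<open>Y\<close>, the
    second controls its integral.\<close>
  define z where "z = (\<lambda>\<omega>. min (\<bar>Z \<omega>\<bar> + real n) (m \<omega> + (\<Sum>t\<le>T. d t \<omega>)))"
  have Z: "integrable M Z" "Z \<in> Y"
    using max_R Y_integrable by (auto simp: Z_def)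
  have m: "integrable M m" and m_bd: "\<And>\<omega>. 0 \<le> m \<omega>" "\<And>\<omega>. m \<omega> \<le> real n" "\<And>\<omega>. m \<omega> \<le> y \<omega>"
    using y by (auto simp: m_def)
  have e: "integrable M (e t)" "AE \<omega> in M. 0 \<le> e t \<omega>" "AE \<omega> in M. e t \<omega> \<le> real n"
    and d: "integrable M (d t)" "(\<integral>\<omega>. d t \<omega> \<partial>M) = (\<integral>\<omega>. y \<omega> \<partial>M) - (\<integral>\<omega>. m \<omega> \<partial>M)" if t: "t \<le> T" for t
  proof -
    interpret Ft: finite_measure_subalgebra M "F t"
      by (rule cond_exp_locale[OF t])
    show e: "integrable M (e t)" "AE \<omega> in M. 0 \<le> e t \<omega>" "AE \<omega> in M. e t \<omega> \<le> real n"
      using m m_bd by (auto simp: e_def intro!: Ft.real_cond_exp_int Ft.real_cond_exp_pos Ft.real_cond_exp_le_c)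
    show "integrable M (d t)"
      using e(1) Ft.real_cond_exp_int(1)[OF y(1)] by (simp add: d_def)
    have "AE \<omega> in M. e t \<omega> \<le> real_cond_exp M (F t) y \<omega>"
      unfolding e_def using m y m_bd by (intro Ft.real_cond_exp_mono) auto
    then have "AE \<omega> in M. d t \<omega> = real_cond_exp M (F t) y \<omega> - e t \<omega>"
      by eventually_elim (simp add: d_def)
    then have "(\<integral>\<omega>. d t \<omega> \<partial>M) = (\<integral>\<omega>. real_cond_exp M (F t) y \<omega> - e t \<omega> \<partial>M)"
      using e(1) Ft.real_cond_exp_int(1)[OF y(1)] by (intro integral_cong_AE) (auto simp: d_def)
    also have "\<dots> = (\<integral>\<omega>. y \<omega> \<partial>M) - (\<integral>\<omega>. m \<omega> \<partial>M)"
      using e(1) Ft.real_cond_exp_int[OF y(1)] Ft.real_cond_exp_int(2)[OF m] by (simp add: e_def)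
    finally show "(\<integral>\<omega>. d t \<omega> \<partial>M) = (\<integral>\<omega>. y \<omega> \<partial>M) - (\<integral>\<omega>. m \<omega> \<partial>M)" .
  qed
  have d_nonneg: "0 \<le> d t \<omega>" for t \<omega>
    by (simp add: d_def)
  have sum_d: "integrable M (\<lambda>\<omega>. \<Sum>t\<le>T. d t \<omega>)"
    using d by auto
  have p_bd: "AE \<omega> in M. \<bar>p t \<omega>\<bar> \<le> real n" if "t \<le> T" for t
    using e(2,3)[OF that]
  proof eventually_elim
    case (elim \<omega>)
    then show ?case
      using m_bd(1,2)[of \<omega>] unfolding p_def by linarith
  qed
  have "p \<in> Linf M (T + 1)"
    using p_bd m e(1) by (auto simp: Linf_def L0_def p_def less_Suc_eq_le intro!: exI[of _ "real n"])
  then have pV: "p \<in> V"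
    using Linf_subset_solid_decomposable_space[OF V] by auto
  have "(\<lambda>_. m) \<in> Linf M (T + 1)"
    using m m_bd by (auto simp: Linf_def L0_def intro!: exI[of _ "real n"])
  then have mV: "(\<lambda>_. m) \<in> V"
    using Linf_subset_solid_decomposable_space[OF V] by auto
  have p_ann: "p \<in> adapted_annihilator M F T X V"
  proof -
    have "pairing M (T + 1) x p = 0" if x: "x \<in> X" "x \<in> adapted_processes F T" for x
    proof -
      have int: "integrable M (\<lambda>\<omega>. x t \<omega> * p t \<omega>)" and zero: "(\<integral>\<omega>. x t \<omega> * p t \<omega> \<partial>M) = 0" if t: "t < T + 1" for t
      proof -
        interpret Ft: finite_measure_subalgebra M "F t"
          using t by (intro cond_exp_locale) simp
        show "integrable M (\<lambda>\<omega>. x t \<omega> * p t \<omega>)"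
          by (rule separating_duality_component_integrable[OF X XV x(1) pV t])
        \<comment> \<open>\<open>x t\<close> may be unbounded. Since the bounded \<open>m\<close>
          lies in \<open>V\<close>, the duality makes \<open>x t * m\<close> integrable, which
          allows the \<open>F t\<close>-measurable factor \<open>x t\<close> to be moved through the
          conditional expectation.\<close>
        have xm: "integrable M (\<lambda>\<omega>. x t \<omega> * m \<omega>)"
          using separating_duality_component_integrable[OF X XV x(1) mV t] by simp
        have xF: "x t \<in> borel_measurable (F t)"
          using x(2) t by (auto simp: adapted_processes_def)
        have "integrable M (\<lambda>\<omega>. x t \<omega> * e t \<omega>)" "(\<integral>\<omega>. x t \<omega> * e t \<omega> \<partial>M) = (\<integral>\<omega>. x t \<omega> * m \<omega> \<partial>M)"
          unfolding e_def using Ft.real_cond_exp_intg[OF xm xF] m by auto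
        then show "(\<integral>\<omega>. x t \<omega> * p t \<omega> \<partial>M) = 0"
          using xm by (simp add: p_def right_diff_distrib)
      qed
      have "pairing M (T + 1) x p = (\<Sum>t<T + 1. \<integral>\<omega>. x t \<omega> * p t \<omega> \<partial>M)"
        unfolding pairing_def using int by (intro Bochner_Integration.integral_sum) auto
      also have "\<dots> = 0"
        using zero by (intro sum.neutral) auto
      finally show ?thesis .
    qed
    then show ?thesis
      using pV by (auto simp: adapted_annihilator_def)
  qed
  have z_meas: "z \<in> borel_measurable M"
    using Z(1) m sum_d by (auto simp: z_def)
  have z_nonneg: "0 \<le> z \<omega>" for \<omega>
    using m_bd(1)[of \<omega>] d_nonneg by (auto simp: z_def intro!: add_nonneg_nonneg sum_nonneg)
  have zY: "z \<in> Y"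
  proof (rule Y_dominated[OF Z(2) z_meas])
    have "\<bar>z \<omega>\<bar> \<le> \<bar>Z \<omega>\<bar> + real n" for \<omega>
      using z_nonneg[of \<omega>] by (simp add: z_def)
    then show "AE \<omega> in M. \<bar>z \<omega>\<bar> \<le> \<bar>Z \<omega>\<bar> + real n"
      by simp
  qed simp
  have le: "AE \<omega> in M. p t \<omega> + R t \<omega> \<le> z \<omega>" if t: "t \<le> T" for t
    using e(2)[OF t] env[OF t]
  proof eventually_elim
    case (elim \<omega>)
    have "d t \<omega> \<le> (\<Sum>t\<le>T. d t \<omega>)"
      using t d_nonneg by (intro member_le_sum) auto
    moreover have "R t \<omega> - e t \<omega> \<le> d t \<omega>"
      using elim by (simp add: d_def)
    moreover have "R t \<omega> \<le> \<bar>Z \<omega>\<bar>"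
      using R_le_max[OF t, of \<omega>] by (simp add: Z_def)
    ultimately show ?case
      using m_bd(2)[of \<omega>] elim unfolding p_def z_def by linarith
  qed
  have "(p, z) \<in> dual_feasible M F T X V Y R"
    using p_ann zY z_nonneg le by (simp add: dual_feasible_def)
  then have "dual_value M F T X V Y R \<le> ereal (\<integral>\<omega>. z \<omega> \<partial>M)"
    unfolding dual_value_def by (rule INF_lower2) simp
  also have "(\<integral>\<omega>. z \<omega> \<partial>M) \<le> (\<integral>\<omega>. m \<omega> + (\<Sum>t\<le>T. d t \<omega>) \<partial>M)"
    using Y_integrable[OF zY] m sum_d by (intro integral_mono) (auto simp: z_def)
  also have "\<dots> = (\<integral>\<omega>. m \<omega> \<partial>M) + (\<Sum>t\<le>T. \<integral>\<omega>. d t \<omega> \<partial>M)"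
    using m sum_d d(1) by simp
  also have "(\<Sum>t\<le>T. \<integral>\<omega>. d t \<omega> \<partial>M) = real (T + 1) * ((\<integral>\<omega>. y \<omega> \<partial>M) - (\<integral>\<omega>. m \<omega> \<partial>M))"
    using d(2) by simp
  finally show ?thesis
    by simp
qed

text \<open>As the height \<open>n\<close> grows, the truncated means converge to the mean of
  \<open>y\<close> by dominated convergence, so the correction, \<open>T + 1\<close> times the
  removed mass, tends to zero.\<close>

lemma dual_value_le:
  assumes y: "integrable M y" "\<And>\<omega>. 0 \<le> y \<omega>"
    and env: "\<And>t. t \<le> T \<Longrightarrow> AE \<omega> in M. R t \<omega> \<le> real_cond_exp M (F t) y \<omega>"
  shows "dual_value M F T X V Y R \<le> ereal (\<integral>\<omega>. y \<omega> \<partial>M)"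
proof -
  define c where "c n = (\<integral>\<omega>. min (y \<omega>) (real n) \<partial>M)" for n :: nat
  have c: "c \<longlonglongrightarrow> (\<integral>\<omega>. y \<omega> \<partial>M)"
    unfolding c_def
  proof (rule integral_dominated_convergence[where w = y])
    show "AE \<omega> in M. (\<lambda>n. min (y \<omega>) (real n)) \<longlonglongrightarrow> y \<omega>"
    proof (rule AE_I2)
      fix \<omega>
      obtain N :: nat where N: "y \<omega> \<le> real N"
        using real_arch_simple by blast
      have "\<forall>\<^sub>F n in sequentially. min (y \<omega>) (real n) = y \<omega>"
        using eventually_ge_at_top[of N] by eventually_elim (use N in auto)
      then show "(\<lambda>n. min (y \<omega>) (real n)) \<longlonglongrightarrow> y \<omega>"
        by (rule tendsto_eventually)
    qed
  qed (use y in auto)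
  have "(\<lambda>n. c n + real (T + 1) * ((\<integral>\<omega>. y \<omega> \<partial>M) - c n))
      \<longlonglongrightarrow> (\<integral>\<omega>. y \<omega> \<partial>M) + real (T + 1) * ((\<integral>\<omega>. y \<omega> \<partial>M) - (\<integral>\<omega>. y \<omega> \<partial>M))"
    by (intro tendsto_intros c)
  then have "(\<lambda>n. ereal (c n + real (T + 1) * ((\<integral>\<omega>. y \<omega> \<partial>M) - c n))) \<longlonglongrightarrow> ereal (\<integral>\<omega>. y \<omega> \<partial>M)"
    by simp
  then show ?thesis
    by (rule LIMSEQ_le_const) (use truncated_dual_value_le[OF y env] in \<open>auto simp: c_def\<close>)
qed

text \<open>The dual value is at most the mean reward of the time built by \<open>snell\<close>,
  which is at most \<open>OS_value\<close>, then \<open>ROS_value\<close>, then the dual value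
  again; hence all are equal.\<close>

lemma optimal_stopping_time:
  obtains \<tau> where "\<tau> \<in> stopping_times M F T" "integrable M (stopped T R \<tau>)"
    "dual_value M F T X V Y R = ereal (\<integral>\<omega>. stopped T R \<tau> \<omega> \<partial>M)"
    "ROS_value M F T R = dual_value M F T X V Y R" "OS_value M F T R = dual_value M F T X V Y R"
proof -
  have pos: "integrable M (\<lambda>\<omega>. max 0 (R t \<omega>))" if "t \<le> T" for t
    by (rule Bochner_Integration.integrable_bound[OF Y_integrable[OF max_R]])
      (use R_le_max[OF that] adapted_measurable[OF R that] in \<open>auto intro!: AE_I2 intro: order_trans[OF _ abs_ge_self]\<close>)
  obtain y \<tau> where y: "integrable M y" "\<And>\<omega>. 0 \<le> y \<omega>" and \<tau>: "\<tau> \<in> stopping_times M F T"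
    and R\<tau>: "integrable M (stopped T R \<tau>)"
    and env: "\<And>t. t \<le> T \<Longrightarrow> AE \<omega> in M. R t \<omega> \<le> real_cond_exp M (F t) y \<omega>"
    and eq: "\<And>A. A \<in> sets (F 0) \<Longrightarrow>
        (\<integral>\<omega>. indicator A \<omega> * y \<omega> \<partial>M) = (\<integral>\<omega>. indicator A \<omega> * stopped T R \<tau> \<omega> \<partial>M)"
    using snell[OF R pos, of 0] by auto
  \<comment> \<open>Taking the whole space as \<open>A\<close> turns the identity on
    \<open>F 0\<close> into equality of the means of \<open>y\<close> and the stopped
    reward.\<close>
  have "space M \<in> sets (F 0)"
    using space_F[of 0] sets.top[of "F 0"] by simp
  from eq[OF this] have "(\<integral>\<omega>. y \<omega> \<partial>M) = (\<integral>\<omega>. stopped T R \<tau> \<omega> \<partial>M)"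
    by (simp cong: Bochner_Integration.integral_cong)
  then have "dual_value M F T X V Y R \<le> ereal (\<integral>\<omega>. stopped T R \<tau> \<omega> \<partial>M)"
    using dual_value_le[OF y env] by simp
  moreover have "ereal (\<integral>\<omega>. stopped T R \<tau> \<omega> \<partial>M) \<le> OS_value M F T R"
    unfolding OS_value_def using \<tau>
    by (rule SUP_upper2) (simp add: OS_objective_def ext_expectation_eq_integral[OF R\<tau>])
  ultimately show ?thesis
    using that[OF \<tau> R\<tau>] OS_value_le_ROS_value ROS_value_le_dual_value by (metis order.trans order.antisym)
qed

section \<open>Complementary slackness\<close>

text \<open>The stopped value of \<open>p\<close> is its pairing with the indicator process of
  \<open>\<tau>\<close>, which is bounded and adapted.\<close>

lemma stopped_annihilator:
  assumes p: "p \<in> adapted_annihilator M F T X V" and \<tau>: "\<tau> \<in> stopping_times M F T"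
  shows "integrable M (stopped T p \<tau>)" "(\<integral>\<omega>. stopped T p \<tau> \<omega> \<partial>M) = 0"
proof -
  have eq: "(\<Sum>t\<le>T. indicator {\<omega> \<in> space M. \<tau> \<omega> = t} \<omega> * p t \<omega>) = stopped T p \<tau> \<omega>" if "\<omega> \<in> space M" for \<omega>
    using sum_stopping_indicator[OF that, of p \<tau>] by (simp add: mult.commute)
  have "AE \<omega> in M. \<bar>indicator {\<omega> \<in> space M. \<tau> \<omega> = t} \<omega> :: real\<bar> \<le> 1" for t
    by (simp add: indicator_def)
  note xp = bounded_adapted_pairing[OF p stopping_indicator_adapted[OF \<tau>] this]
  have "integrable M (\<lambda>\<omega>. \<Sum>t\<le>T. indicator {\<omega> \<in> space M. \<tau> \<omega> = t} \<omega> * p t \<omega>)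
      \<longleftrightarrow> integrable M (stopped T p \<tau>)"
    by (rule Bochner_Integration.integrable_cong[OF refl]) (rule eq)
  with xp(1) show "integrable M (stopped T p \<tau>)"
    by (rule iffD1[rotated])
  have "(\<integral>\<omega>. (\<Sum>t\<le>T. indicator {\<omega> \<in> space M. \<tau> \<omega> = t} \<omega> * p t \<omega>) \<partial>M) = (\<integral>\<omega>. stopped T p \<tau> \<omega> \<partial>M)"
    by (rule Bochner_Integration.integral_cong[OF refl]) (rule eq)
  from this[symmetric] xp(2) show "(\<integral>\<omega>. stopped T p \<tau> \<omega> \<partial>M) = 0"
    by (rule trans)
qed

text \<open>The slack \<open>y\<close> minus the stopped values of \<open>p\<close> and
  \<open>R\<close> has mean equal to that of \<open>y\<close> minus the mean reward, since
  \<open>p\<close> contributes zero. At an optimal time this mean vanishes for a dual solution;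
  conversely, zero slack makes \<open>y\<close> attain the common value.\<close>

lemma solves_dual_iff:
  assumes py: "(p, y) \<in> dual_feasible M F T X V Y R"
  shows "solves_dual M F T X V Y R p y \<longleftrightarrow>
    (\<exists>\<tau>\<in>stopping_times M F T. AE \<omega> in M. stopped T p \<tau> \<omega> + stopped T R \<tau> \<omega> = y \<omega>)"
proof -
  have p: "p \<in> adapted_annihilator M F T X V" and y: "integrable M y" and y_pos: "AE \<omega> in M. 0 \<le> y \<omega>"
    and le: "AE \<omega> in M. \<forall>t\<in>{..T}. p t \<omega> + R t \<omega> \<le> y \<omega>"
    using py by (auto simp: dual_feasible_def AE_finite_all intro: Y_integrable)
  obtain \<tau> where \<tau>: "\<tau> \<in> stopping_times M F T" and R\<tau>: "integrable M (stopped T R \<tau>)"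
    and opt: "dual_value M F T X V Y R = ereal (\<integral>\<omega>. stopped T R \<tau> \<omega> \<partial>M)"
    and OS: "OS_value M F T R = dual_value M F T X V Y R"
    using optimal_stopping_time by metis
  show ?thesis
  proof
    assume "solves_dual M F T X V Y R p y"
    then have Ey: "(\<integral>\<omega>. y \<omega> \<partial>M) = (\<integral>\<omega>. stopped T R \<tau> \<omega> \<partial>M)"
      using opt by (simp add: solves_dual_def)
    note p\<tau> = stopped_annihilator[OF p \<tau>]
    define g where "g = (\<lambda>\<omega>. y \<omega> - (stopped T p \<tau> \<omega> + stopped T R \<tau> \<omega>))"
    have "integrable M g" "(\<integral>\<omega>. g \<omega> \<partial>M) = 0"
      using y R\<tau> p\<tau> Ey by (auto simp: g_def)
    \<comment> \<open>If \<open>\<tau> \<omega> \<le> T\<close> this is the dual constraint at that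
      time; if \<open>\<tau> \<omega> = T + 1\<close> both stopped values are 0 and it is
      \<open>y \<ge> 0\<close>.\<close>
    moreover have "AE \<omega> in M. 0 \<le> g \<omega>"
      using y_pos le by eventually_elim (auto simp: g_def stopped_def)
    ultimately have "AE \<omega> in M. g \<omega> = 0"
      using integral_nonneg_eq_0_iff_AE by blast
    then have "AE \<omega> in M. stopped T p \<tau> \<omega> + stopped T R \<tau> \<omega> = y \<omega>"
      by eventually_elim (simp add: g_def)
    then show "\<exists>\<tau>\<in>stopping_times M F T. AE \<omega> in M. stopped T p \<tau> \<omega> + stopped T R \<tau> \<omega> = y \<omega>"
      using \<tau> by blast
  next
    assume "\<exists>\<tau>\<in>stopping_times M F T. AE \<omega> in M. stopped T p \<tau> \<omega> + stopped T R \<tau> \<omega> = y \<omega>"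
    then obtain \<sigma> where \<sigma>: "\<sigma> \<in> stopping_times M F T"
      and eq: "AE \<omega> in M. stopped T p \<sigma> \<omega> + stopped T R \<sigma> \<omega> = y \<omega>"
      by blast
    note p\<sigma> = stopped_annihilator[OF p \<sigma>]
    \<comment> \<open>The reward stopped at an arbitrary \<open>\<sigma>\<close> is not integrable a
      priori. Given measurability, it inherits integrability from
      \<open>y - stopped T p \<sigma>\<close>, with which it agrees almost surely.\<close>
    have meas: "stopped T R \<sigma> \<in> borel_measurable M"
    proof -
      have "(\<lambda>\<omega>. \<Sum>t\<le>T. R t \<omega> * indicator {\<omega> \<in> space M. \<sigma> \<omega> = t} \<omega>) \<in> borel_measurable M"
        using adapted_measurable[OF R] adapted_measurable[OF stopping_indicator_adapted[OF \<sigma>]]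
        by (intro borel_measurable_sum borel_measurable_times) simp_all
      also have "?this \<longleftrightarrow> ?thesis"
        by (rule measurable_cong) (rule sum_stopping_indicator)
      finally show ?thesis .
    qed
    have diff: "AE \<omega> in M. y \<omega> - stopped T p \<sigma> \<omega> = stopped T R \<sigma> \<omega>"
      using eq by eventually_elim simp
    have int: "integrable M (\<lambda>\<omega>. y \<omega> - stopped T p \<sigma> \<omega>)"
      using y p\<sigma>(1) by (rule Bochner_Integration.integrable_diff)
    have R\<sigma>: "integrable M (stopped T R \<sigma>)"
      by (rule integrable_cong_AE_imp[OF int meas diff])
    have "(\<integral>\<omega>. y \<omega> - stopped T p \<sigma> \<omega> \<partial>M) = (\<integral>\<omega>. stopped T R \<sigma> \<omega> \<partial>M)"
      by (rule integral_cong_AE[OF borel_measurable_integrable[OF int] meas diff])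
    then have "(\<integral>\<omega>. stopped T R \<sigma> \<omega> \<partial>M) = (\<integral>\<omega>. y \<omega> \<partial>M)"
      using y p\<sigma> by simp
    then have "ereal (\<integral>\<omega>. y \<omega> \<partial>M) \<le> OS_value M F T R"
      unfolding OS_value_def using \<sigma>
      by (intro SUP_upper2[of \<sigma>]) (simp_all add: OS_objective_def ext_expectation_eq_integral[OF R\<sigma>])
    moreover have "dual_value M F T X V Y R \<le> ereal (\<integral>\<omega>. y \<omega> \<partial>M)"
      unfolding dual_value_def using py by (rule INF_lower2) simp
    ultimately show "solves_dual M F T X V Y R p y"
      using py OS by (simp add: solves_dual_def)
  qed
qed

end

theorem theorem40:
  fixes M :: "'a measure" and F :: "nat \<Rightarrow> 'a measure" and T :: nat
    and X V :: "(nat \<Rightarrow> 'a \<Rightarrow> real) set" and U Y :: "('a \<Rightarrow> real) set"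
    and R :: "nat \<Rightarrow> 'a \<Rightarrow> real"
  assumes "prob_space M"
    and "finite_filtration M F T"
    and "solid_decomposable_space M (T + 1) X"
    and "solid_decomposable_space M (T + 1) V"
    and "separating_duality M (T + 1) X V"
    and "solid_decomposable_space M 1 (scalar_space U)"
    and "solid_decomposable_space M 1 (scalar_space Y)"
    and "separating_duality M 1 (scalar_space U) (scalar_space Y)"
    and "R \<in> adapted_processes F T"
    and "(\<lambda>\<omega>. Max ((\<lambda>t. R t \<omega>) ` {0..T})) \<in> Y"
  shows "OS_value M F T R = ROS_value M F T R
    \<and> ROS_value M F T R = dual_value M F T X V Y R
    \<and> (\<exists>\<tau>. solves_OS M F T R \<tau>)
    \<and> (\<exists>x. solves_ROS M F T R x)
    \<and> (\<forall>p y. (p, y) \<in> dual_feasible M F T X V Y R \<longrightarrow>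
          (solves_dual M F T X V Y R p y \<longleftrightarrow>
           (\<exists>\<tau>\<in>stopping_times M F T. AE \<omega> in M. stopped T p \<tau> \<omega> + stopped T R \<tau> \<omega> = y \<omega>)))"
proof -
  interpret prob_space M by fact
  interpret stopping_duality M F T X V U Y R
    by unfold_locales (fact assms)+
  obtain \<tau> where \<tau>: "\<tau> \<in> stopping_times M F T" and R\<tau>: "integrable M (stopped T R \<tau>)"
    and opt: "dual_value M F T X V Y R = ereal (\<integral>\<omega>. stopped T R \<tau> \<omega> \<partial>M)"
    and ROS: "ROS_value M F T R = dual_value M F T X V Y R"
    and OS: "OS_value M F T R = dual_value M F T X V Y R"
    by (rule optimal_stopping_time)
  have obj: "OS_objective M T R \<tau> = dual_value M F T X V Y R"
    using opt by (simp add: OS_objective_def ext_expectation_eq_integral[OF R\<tau>])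
  have "solves_OS M F T R \<tau>"
    using \<tau> obj OS by (simp add: solves_OS_def)
  moreover have "solves_ROS M F T R (\<lambda>t. indicator {\<omega> \<in> space M. \<tau> \<omega> = t})"
    using stopping_indicator_feasible[OF \<tau>] obj ROS
    by (simp add: solves_ROS_def ROS_objective_stopping_indicator)
  ultimately show ?thesis
    using OS ROS solves_dual_iff by auto
qed

end
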